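(* Let $X$ and $Y$ be Banach spaces, and let $S\in L(X,Y)$ and $T\in L(Y,X)$ be regular operators such that $R(ST)\subseteq Y$ and $R(TS)\subseteq X$ are finite dimensional. Let $\mathcal{X}=X/R(TS)$, $\mathcal{Y}=Y/R(ST)$, and let $\tilde S\in L(\mathcal{X},\mathcal{Y})$, $\tilde T\in L(\mathcal{Y},\mathcal{X})$ be the operators induced by $S$ and $T$. Let $\tilde S'\in L(\mathcal{Y},\mathcal{X})$ and $\tilde T'\in L(\mathcal{X},\mathcal{Y})$ be normalized generalized inverses of $\tilde S$ and $\tilde T$ respectively such that $\tilde S'\tilde T'=0$ and $\tilde T'\tilde S'=0$. Let $S'\in L(Y,X)$ and $T'\in L(X,Y)$ be the extensions of $\tilde S'$ and $\tilde T'$ with $S'=0$ on $R(ST)$ and $T'=0$ on $R(TS)$ (as described in the context). Then the following statements are equivalent: (i) $(S,T)$ is a regular Fredholm pair. (ii) $S+T'\in L(X,Y)$ is a Fredholm operator. (iii) $T+S'\in L(Y,X)$ is a Fredholm operator. Furthermore, in this case $$\operatorname{ind}(S,T)=\operatorname{ind}(S+T')=-\operatorname{ind}(T+S').$$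
   Context: $L(X,Y)$ denotes the bounded linear operators from $X$ to $Y$; $N(\cdot)$ and $R(\cdot)$ denote null space and range. An operator $A\in L(X,Y)$ is regular if there is $B\in L(Y,X)$ with $A=ABA$; such a $B$ is a generalized inverse of $A$, and it is a normalized generalized inverse if in addition $B=BAB$. Fredholm pairs: for $S\in L(X,Y)$ and $T\in L(Y,X)$, the pair $(S,T)$ is a Fredholm pair if the following dimensions are finite: $a=\dim N(S)/(N(S)\cap R(T))$, $b=\dim R(T)/(N(S)\cap R(T))$, $c=\dim N(T)/(N(T)\cap R(S))$, $d=\dim R(S)/(N(T)\cap R(S))$. Its index is $\operatorname{ind}(S,T)=a-b-c+d$. A Fredholm pair $(S,T)$ is a regular Fredholm pair if $S$ and $T$ are regular operators. For a Fredholm operator $A$, $\operatorname{ind}(A)=\dim N(A)-\operatorname{codim}R(A)$. Induced operators: with $\pi_X\colon X\to\mathcal{X}$ and $\pi_Y\colon Y\to\mathcal{Y}$ the quotient maps, $\tilde S$ and $\tilde T$ are determined by $\tilde S\pi_X=\pi_Y S$ and $\tilde T\pi_Y=\pi_X T$; they satisfy $\tilde S\tilde T=0$ and $\tilde T\tilde S=0$. When $S$ and $T$ are regular, so are $\tilde S$ and $\tilde T$, and normalized generalized inverses $\tilde S',\tilde T'$ with $\tilde S'\tilde T'=0$, $\tilde T'\tilde S'=0$ exist. Extensions: fix closed subspaces $X_0\subseteq X$ and $Y_0\subseteq Y$ with $X=R(TS)\oplus X_0$ and $Y=R(ST)\oplus Y_0$. Then $\pi_X|_{X_0}\colon X_0\to\mathcal{X}$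 and $\pi_Y|_{Y_0}\colon Y_0\to\mathcal{Y}$ are isomorphisms, by means of which $\tilde S'$ and $\tilde T'$ are viewed as operators $Y_0\to X_0$ and $X_0\to Y_0$. The operators $S'$ and $T'$ are the extensions of these that vanish on $R(ST)$ and $R(TS)$ respectively, i.e. $S'=(\pi_X|_{X_0})^{-1}\tilde S'\pi_Y$ and $T'=(\pi_Y|_{Y_0})^{-1}\tilde T'\pi_X$. *)

theory Defs
  imports Complex_Main
begin

text \<open>
  Banach spaces over an arbitrary complete valued scalar field containing the reals. By the
  Gelfand--Mazur theorem these scalar fields are just \<open>\<real>\<close> and \<open>\<complex>\<close>, so that real and complex
  Banach spaces are treated at once; see the two instances below. The class \<open>banach\<close> supplies
  the underlying real Banach space.
\<close>

locale banach_over = vector_space scale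
  for scale :: "'k::{real_normed_field,banach} \<Rightarrow> 'a::banach \<Rightarrow> 'a" +
  assumes scale_of_real: "scale (of_real r) x = r *\<^sub>R x"
    and norm_scale: "norm (scale c x) = norm c * norm x"

lemma banach_over_scaleR: "banach_over (scaleR :: real \<Rightarrow> 'a::banach \<Rightarrow> 'a)"
  by unfold_locales (auto simp: algebra_simps)

lemma banach_over_mult:
  "banach_over ((*) :: 'k \<Rightarrow> 'k \<Rightarrow> 'k::{real_normed_field,banach})"
  by unfold_locales (auto simp: algebra_simps norm_mult scaleR_conv_of_real)


section \<open>Bounded operators\<close>

definition bounded_op ::
  "('k \<Rightarrow> 'a::real_normed_vector \<Rightarrow> 'a) \<Rightarrow> ('k \<Rightarrow> 'b::real_normed_vector \<Rightarrow> 'b) \<Rightarrow> ('a \<Rightarrow> 'b) \<Rightarrow> bool"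
where
  "bounded_op sX sY A \<longleftrightarrow> bounded_linear A \<and> (\<forall>c x. A (sX c x) = sY c (A x))"

definition null_space :: "('a \<Rightarrow> 'b::zero) \<Rightarrow> 'a set" where
  "null_space A = {x. A x = 0}"

definition regular_op ::
  "('k \<Rightarrow> 'a::real_normed_vector \<Rightarrow> 'a) \<Rightarrow> ('k \<Rightarrow> 'b::real_normed_vector \<Rightarrow> 'b) \<Rightarrow> ('a \<Rightarrow> 'b) \<Rightarrow> bool"
where
  "regular_op sX sY A \<longleftrightarrow>
     bounded_op sX sY A \<and> (\<exists>B. bounded_op sY sX B \<and> A = A \<circ> B \<circ> A)"

definition finite_dim :: "('k::field \<Rightarrow> 'a::ab_group_add \<Rightarrow> 'a) \<Rightarrow> 'a set \<Rightarrow> bool" where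
  "finite_dim s V \<longleftrightarrow> (\<exists>B. finite B \<and> B \<subseteq> V \<and> V \<subseteq> module.span s B)"


section \<open>Quotient spaces\<close>

text \<open>
  For a subspace \<open>M\<close>, the quotient by \<open>M\<close> is the set of cosets \<open>x + M\<close>, its zero vector is
  the coset \<open>M\<close>, and the quotient map is \<open>quot_map M\<close>.
\<close>

definition quot_map :: "'a::ab_group_add set \<Rightarrow> 'a \<Rightarrow> 'a set" where
  "quot_map M x = {x + m | m. m \<in> M}"

definition quot_space :: "'a::ab_group_add set \<Rightarrow> 'a set set" where
  "quot_space M = range (quot_map M)"

definition quot_add :: "'a::ab_group_add set \<Rightarrow> 'a set \<Rightarrow> 'a set" where
  "quot_add C D = {x + y | x y. x \<in> C \<and> y \<in> D}"

text \<open>The summand from \<open>M\<close> only matters for \<open>c = 0\<close>.\<close>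

definition quot_scale ::
  "('k \<Rightarrow> 'a::ab_group_add \<Rightarrow> 'a) \<Rightarrow> 'a set \<Rightarrow> 'k \<Rightarrow> 'a set \<Rightarrow> 'a set" where
  "quot_scale s M c C = {s c x + m | x m. x \<in> C \<and> m \<in> M}"

definition quot_norm :: "'a::real_normed_vector set \<Rightarrow> real" where
  "quot_norm C = (INF x\<in>C. norm x)"

text \<open>
  Operators on quotient spaces are functions on cosets; their values outside of
  \<open>quot_space M\<close> are irrelevant.
\<close>

definition quot_bounded_op ::
  "('k \<Rightarrow> 'a::real_normed_vector \<Rightarrow> 'a) \<Rightarrow> 'a set \<Rightarrow> ('k \<Rightarrow> 'b::real_normed_vector \<Rightarrow> 'b) \<Rightarrow> 'b set \<Rightarrow>
   ('a set \<Rightarrow> 'b set) \<Rightarrow> bool"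
where
  "quot_bounded_op sX M sY N A \<longleftrightarrow>
     (\<forall>C\<in>quot_space M. A C \<in> quot_space N) \<and>
     (\<forall>C\<in>quot_space M. \<forall>D\<in>quot_space M. A (quot_add C D) = quot_add (A C) (A D)) \<and>
     (\<forall>c. \<forall>C\<in>quot_space M. A (quot_scale sX M c C) = quot_scale sY N c (A C)) \<and>
     (\<exists>K. \<forall>C\<in>quot_space M. quot_norm (A C) \<le> K * quot_norm C)"

definition induced_op ::
  "('a::ab_group_add \<Rightarrow> 'b::ab_group_add) \<Rightarrow> 'a set \<Rightarrow> 'b set \<Rightarrow> ('a set \<Rightarrow> 'b set) \<Rightarrow> bool" where
  "induced_op S M N S\<^sub>q \<longleftrightarrow> (\<forall>x. S\<^sub>q (quot_map M x) = quot_map N (S x))"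

definition quot_normalized_ginv ::
  "('k \<Rightarrow> 'a::real_normed_vector \<Rightarrow> 'a) \<Rightarrow> 'a set \<Rightarrow> ('k \<Rightarrow> 'b::real_normed_vector \<Rightarrow> 'b) \<Rightarrow> 'b set \<Rightarrow>
   ('a set \<Rightarrow> 'b set) \<Rightarrow> ('b set \<Rightarrow> 'a set) \<Rightarrow> bool"
where
  "quot_normalized_ginv sX M sY N A B \<longleftrightarrow>
     quot_bounded_op sX M sY N A \<and> quot_bounded_op sY N sX M B \<and>
     (\<forall>C\<in>quot_space M. A C = A (B (A C))) \<and>
     (\<forall>D\<in>quot_space N. B D = B (A (B D)))"


section \<open>Dimension of quotients\<close>

text \<open>
  \<open>quot_basis s V M B\<close>: the elements of \<open>B\<close> represent, without repetition, a finite basis of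
  the quotient \<open>V/M\<close> (for subspaces \<open>M \<subseteq> V\<close>).
\<close>

definition quot_basis ::
  "('k::field \<Rightarrow> 'a::ab_group_add \<Rightarrow> 'a) \<Rightarrow> 'a set \<Rightarrow> 'a set \<Rightarrow> 'a set \<Rightarrow> bool" where
  "quot_basis s V M B \<longleftrightarrow> finite B \<and> B \<subseteq> V \<and>
     (\<forall>c. quot_map M (\<Sum>b\<in>B. s (c b) b) = quot_map M 0 \<longrightarrow> (\<forall>b\<in>B. c b = 0)) \<and>
     (\<forall>x\<in>V. \<exists>c. quot_map M x = quot_map M (\<Sum>b\<in>B. s (c b) b))"

definition quot_finite_dim ::
  "('k::field \<Rightarrow> 'a::ab_group_add \<Rightarrow> 'a) \<Rightarrow> 'a set \<Rightarrow> 'a set \<Rightarrow> bool" where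
  "quot_finite_dim s V M \<longleftrightarrow> (\<exists>B. quot_basis s V M B)"

definition quot_dim ::
  "('k::field \<Rightarrow> 'a::ab_group_add \<Rightarrow> 'a) \<Rightarrow> 'a set \<Rightarrow> 'a set \<Rightarrow> nat" where
  "quot_dim s V M = card (SOME B. quot_basis s V M B)"


section \<open>Fredholm operators and Fredholm pairs\<close>

definition fredholm_op ::
  "('k::field \<Rightarrow> 'a::real_normed_vector \<Rightarrow> 'a) \<Rightarrow> ('k \<Rightarrow> 'b::real_normed_vector \<Rightarrow> 'b) \<Rightarrow>
   ('a \<Rightarrow> 'b) \<Rightarrow> bool"
where
  "fredholm_op sX sY A \<longleftrightarrow>
     bounded_op sX sY A \<and> finite_dim sX (null_space A) \<and> quot_finite_dim sY UNIV (range A)"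

definition fredholm_index ::
  "('k::field \<Rightarrow> 'a::real_normed_vector \<Rightarrow> 'a) \<Rightarrow> ('k \<Rightarrow> 'b::real_normed_vector \<Rightarrow> 'b) \<Rightarrow>
   ('a \<Rightarrow> 'b) \<Rightarrow> int"
where
  "fredholm_index sX sY A =
     int (vector_space.dim sX (null_space A)) - int (quot_dim sY UNIV (range A))"

definition fredholm_pair ::
  "('k::field \<Rightarrow> 'a::real_normed_vector \<Rightarrow> 'a) \<Rightarrow> ('k \<Rightarrow> 'b::real_normed_vector \<Rightarrow> 'b) \<Rightarrow>
   ('a \<Rightarrow> 'b) \<Rightarrow> ('b \<Rightarrow> 'a) \<Rightarrow> bool"
where
  "fredholm_pair sX sY S T \<longleftrightarrow>
     bounded_op sX sY S \<and> bounded_op sY sX T \<and>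
     quot_finite_dim sX (null_space S) (null_space S \<inter> range T) \<and>
     quot_finite_dim sX (range T) (null_space S \<inter> range T) \<and>
     quot_finite_dim sY (null_space T) (null_space T \<inter> range S) \<and>
     quot_finite_dim sY (range S) (null_space T \<inter> range S)"

definition fredholm_pair_index ::
  "('k::field \<Rightarrow> 'a::real_normed_vector \<Rightarrow> 'a) \<Rightarrow> ('k \<Rightarrow> 'b::real_normed_vector \<Rightarrow> 'b) \<Rightarrow>
   ('a \<Rightarrow> 'b) \<Rightarrow> ('b \<Rightarrow> 'a) \<Rightarrow> int"
where
  "fredholm_pair_index sX sY S T =
     int (quot_dim sX (null_space S) (null_space S \<inter> range T))
     - int (quot_dim sX (range T) (null_space S \<inter> range T))
     - int (quot_dim sY (null_space T) (null_space T \<inter> range S))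
     + int (quot_dim sY (range S) (null_space T \<inter> range S))"

definition regular_fredholm_pair ::
  "('k::field \<Rightarrow> 'a::real_normed_vector \<Rightarrow> 'a) \<Rightarrow> ('k \<Rightarrow> 'b::real_normed_vector \<Rightarrow> 'b) \<Rightarrow>
   ('a \<Rightarrow> 'b) \<Rightarrow> ('b \<Rightarrow> 'a) \<Rightarrow> bool"
where
  "regular_fredholm_pair sX sY S T \<longleftrightarrow>
     fredholm_pair sX sY S T \<and> regular_op sX sY S \<and> regular_op sY sX T"


section \<open>Complements and extensions\<close>

definition closed_complement ::
  "('k::field \<Rightarrow> 'a::real_normed_vector \<Rightarrow> 'a) \<Rightarrow> 'a set \<Rightarrow> 'a set \<Rightarrow> bool" where
  "closed_complement s M X\<^sub>0 \<longleftrightarrow>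
     module.subspace s X\<^sub>0 \<and> closed X\<^sub>0 \<and> M \<inter> X\<^sub>0 = {0} \<and> (\<forall>x. \<exists>m\<in>M. \<exists>z\<in>X\<^sub>0. x = m + z)"

text \<open>
  If \<open>X\<^sub>0\<close> is a complement of \<open>M\<close>, then \<open>quot_map M\<close> is a bijection from \<open>X\<^sub>0\<close> onto
  \<open>quot_space M\<close>, and the operator \<open>B\<close> from the quotient by \<open>N\<close> to the quotient by \<open>M\<close>
  extends to an operator which vanishes on \<open>N\<close> and takes values in \<open>X\<^sub>0\<close>.
\<close>

definition extension_op ::
  "'b::ab_group_add set \<Rightarrow> 'a::ab_group_add set \<Rightarrow> 'a set \<Rightarrow> ('b set \<Rightarrow> 'a set) \<Rightarrow> 'b \<Rightarrow> 'a" where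
  "extension_op N M X\<^sub>0 B y = the_inv_into X\<^sub>0 (quot_map M) (B (quot_map N y))"

end

theory Submission imports Defs "HOL-Analysis.Elementary_Topology" begin

text \<open>
  Put \<open>A = S + T'\<close>, \<open>M = R(TS)\<close>, \<open>N = R(ST)\<close> and \<open>K = A\<^sup>-\<^sup>1(N)\<close>. The relations between the
  operators give \<open>K = {x. S x \<in> N \<and> T' x = 0}\<close>, and they identify \<open>N(S)/(N(S) \<inter> R(T))\<close> with \<open>K/M\<close>
  (by \<open>x \<mapsto> x - TT'x\<close>) and \<open>N(T)/(N(T) \<inter> R(S))\<close> with \<open>Y/(R(A) + N)\<close> (by inclusion). Moreover
  \<open>A\<close> identifies \<open>K/N(A)\<close> with \<open>N \<inter> R(A)\<close>, and \<open>(R(A) + N)/R(A)\<close> is \<open>N/(N \<inter> R(A))\<close>. Counting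
  dimensions along \<open>N(A) \<subseteq> K \<supseteq> M\<close> and \<open>R(A) \<subseteq> R(A) + N \<subseteq> Y\<close>, with \<open>a\<close> and \<open>c\<close> as in the
  index of the pair, yields \<open>ind A = a + dim M - dim N - c\<close>. Since \<open>S\<close> and \<open>T\<close> induce isomorphisms
  from \<open>R(T)/(N(S) \<inter> R(T))\<close> onto \<open>N\<close> and from \<open>R(S)/(N(T) \<inter> R(S))\<close> onto \<open>M\<close>, this is the index
  of the pair. The statements on \<open>T + S'\<close> follow by exchanging the roles of the two spaces.
\<close>

section \<open>Dimensions of quotients\<close>

text \<open>A relational form of the dimension: it carries finiteness and value together and avoids
  the choice inside \<open>quot_dim\<close>, so both can be transported by one equivalence.\<close>

definition has_quot_dim ::
  "('k::field \<Rightarrow> 'a::ab_group_add \<Rightarrow> 'a) \<Rightarrow> 'a set \<Rightarrow> 'a set \<Rightarrow> nat \<Rightarrow> bool" where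
  "has_quot_dim s V M n \<longleftrightarrow> (\<exists>B. quot_basis s V M B \<and> card B = n)"

text \<open>Linear independence of the cosets of \<open>B\<close> modulo \<open>M\<close>, expressed
  in the ambient space: \<open>B\<close> is independent and the quotient map is injective on its
  span.\<close>

definition indep_mod ::
  "('k::field \<Rightarrow> 'a::ab_group_add \<Rightarrow> 'a) \<Rightarrow> 'a set \<Rightarrow> 'a set \<Rightarrow> bool" where
  "indep_mod s M B \<longleftrightarrow> finite B \<and> \<not> module.dependent s B \<and> module.span s B \<inter> M \<subseteq> {0}"

lemma quot_finite_dim_iff: "quot_finite_dim s V M \<longleftrightarrow> (\<exists>n. has_quot_dim s V M n)"
  by (auto simp: quot_finite_dim_def has_quot_dim_def)

section \<open>Families independent modulo a subspace, and the dimension they define\<close>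

context vector_space
begin

lemma quot_map_eq_iff:
  assumes "subspace M"
  shows "quot_map M x = quot_map M y \<longleftrightarrow> x - y \<in> M"
proof
  assume "quot_map M x = quot_map M y"
  moreover have "x \<in> quot_map M x"
    using subspace_0[OF assms] by (force simp: quot_map_def)
  ultimately obtain m where "x = y + m" "m \<in> M"
    by (auto simp: quot_map_def)
  then show "x - y \<in> M" by simp
next
  assume *: "x - y \<in> M"
  show "quot_map M x = quot_map M y"
  proof (intro equalityI subsetI)
    fix z assume "z \<in> quot_map M x"
    then obtain m where "z = x + m" "m \<in> M" by (auto simp: quot_map_def)
    then have "z = y + ((x - y) + m)" "(x - y) + m \<in> M"
      using subspace_add[OF assms *] by (auto simp: algebra_simps)
    then show "z \<in> quot_map M y" unfolding quot_map_def by blast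
  next
    fix z assume "z \<in> quot_map M y"
    then obtain m where "z = y + m" "m \<in> M" by (auto simp: quot_map_def)
    then have "z = x + (m - (x - y))" "m - (x - y) \<in> M"
      using subspace_diff[OF assms _ *] by (auto simp: algebra_simps)
    then show "z \<in> quot_map M x" unfolding quot_map_def by blast
  qed
qed

lemma indep_mod_iff:
  assumes "subspace M"
  shows "indep_mod scale M B \<longleftrightarrow>
    finite B \<and> (\<forall>c. (\<Sum>b\<in>B. scale (c b) b) \<in> M \<longrightarrow> (\<forall>b\<in>B. c b = 0))"
proof (cases "finite B")
  case True
  show ?thesis
    unfolding indep_mod_def span_finite[OF True] dependent_finite[OF True]
  proof (intro iffI conjI allI impI True; (elim conjE)?)
    fix c
    assume "\<not> (\<exists>u. (\<exists>v\<in>B. u v \<noteq> 0) \<and> (\<Sum>v\<in>B. scale (u v) v) = 0)"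
      and "range (\<lambda>u. \<Sum>v\<in>B. scale (u v) v) \<inter> M \<subseteq> {0}"
      and "(\<Sum>b\<in>B. scale (c b) b) \<in> M"
    then show "\<forall>b\<in>B. c b = 0" by blast
  next
    assume *: "\<forall>c. (\<Sum>b\<in>B. scale (c b) b) \<in> M \<longrightarrow> (\<forall>b\<in>B. c b = 0)"
    then show "\<not> (\<exists>u. (\<exists>v\<in>B. u v \<noteq> 0) \<and> (\<Sum>v\<in>B. scale (u v) v) = 0)"
      using subspace_0[OF assms] by metis
    show "range (\<lambda>u. \<Sum>v\<in>B. scale (u v) v) \<inter> M \<subseteq> {0}"
      using * by (auto intro!: sum.neutral)
  qed
qed (simp add: indep_mod_def)

lemma quot_basis_iff:
  assumes "subspace M"
  shows "quot_basis scale V M B \<longleftrightarrow>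
    B \<subseteq> V \<and> indep_mod scale M B \<and> (\<forall>x\<in>V. \<exists>w\<in>span B. x - w \<in> M)"
proof (cases "finite B")
  case True
  have "(\<exists>c. x - (\<Sum>b\<in>B. scale (c b) b) \<in> M) \<longleftrightarrow> (\<exists>w\<in>span B. x - w \<in> M)" for x
    unfolding span_finite[OF True] by blast
  with True show ?thesis
    unfolding quot_basis_def quot_map_eq_iff[OF assms] indep_mod_iff[OF assms]
    by auto
qed (simp add: quot_basis_def indep_mod_def)

lemma indep_mod_card_le:
  assumes M: "subspace M" and B: "indep_mod scale M B" and D: "finite D"
    and le: "\<And>b. b \<in> B \<Longrightarrow> \<exists>w\<in>span D. b - w \<in> M"
  shows "card B \<le> card D"
proof -
  have fB: "finite B" and iB: "independent B" and sB: "span B \<inter> M \<subseteq> {0}"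
    using B by (auto simp: indep_mod_def)
  obtain u where u: "\<And>b. b \<in> B \<Longrightarrow> u b \<in> span D" "\<And>b. b \<in> B \<Longrightarrow> b - u b \<in> M"
    using le by metis
  have inj: "inj_on u B"
  proof (rule inj_onI)
    fix b b' assume b: "b \<in> B" "b' \<in> B" "u b = u b'"
    have "(b - u b) - (b' - u b') \<in> M"
      using subspace_diff[OF M u(2)[OF b(1)] u(2)[OF b(2)]] .
    then have "b - b' \<in> M" using b by simp
    moreover have "b - b' \<in> span B"
      using b by (intro span_diff span_base)
    ultimately show "b = b'" using sB by auto
  qed
  have "independent (u ` B)"
    unfolding dependent_finite[OF finite_imageI[OF fB]]
  proof (safe, goal_cases)
    case (1 c v b)
    have "(\<Sum>b\<in>B. scale (c (u b)) (u b)) = 0"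
      using 1(1) sum.reindex[OF inj, of "\<lambda>v. scale (c v) v"] by simp
    \<comment> \<open>A relation among the \<open>u b\<close> becomes a relation modulo
      \<open>M\<close> among the \<open>b\<close>, because every \<open>b - u b\<close> lies in
      \<open>M\<close>.\<close>
    then have "(\<Sum>b\<in>B. scale (c (u b)) b) = (\<Sum>b\<in>B. scale (c (u b)) (b - u b))"
      by (simp add: scale_right_diff_distrib sum_subtractf)
    also have "\<dots> \<in> M"
      using u(2) by (intro subspace_sum[OF M] subspace_scale[OF M]) auto
    finally have "\<forall>b\<in>B. c (u b) = 0"
      using B unfolding indep_mod_iff[OF M] by (elim conjE allE[of _ "\<lambda>b. c (u b)"]) blast
    with 1 show ?case by auto
  qed
  then have "card (u ` B) \<le> card D"
    using independent_span_bound[OF D] u(1) by blast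
  then show ?thesis by (simp add: card_image[OF inj])
qed

lemma indep_mod_card_le_dim:
  assumes "subspace M" "has_quot_dim scale V M n" "indep_mod scale M B" "B \<subseteq> V"
  shows "card B \<le> n"
proof -
  obtain D where D: "quot_basis scale V M D" "card D = n"
    using assms by (auto simp: has_quot_dim_def)
  then have "finite D" "\<forall>x\<in>V. \<exists>w\<in>span D. x - w \<in> M"
    using quot_basis_iff[OF assms(1)] by (auto simp: indep_mod_def)
  with assms D(2) show ?thesis
    using indep_mod_card_le[of M B D] by blast
qed

lemma has_quot_dim_unique:
  assumes "subspace M" "has_quot_dim scale V M n" "has_quot_dim scale V M n'"
  shows "n = n'"
proof -
  have "k \<le> l" if "has_quot_dim scale V M k" "has_quot_dim scale V M l" for k l
    using that indep_mod_card_le_dim[OF assms(1) that(2)] quot_basis_iff[OF assms(1)]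
    unfolding has_quot_dim_def by blast
  with assms show ?thesis by (simp add: order_antisym)
qed

lemma quot_dim_eq:
  assumes "subspace M" "has_quot_dim scale V M n"
  shows "quot_dim scale V M = n"
proof -
  have "quot_basis scale V M (SOME B. quot_basis scale V M B)"
    using assms(2) unfolding has_quot_dim_def by (metis someI)
  then have "has_quot_dim scale V M (quot_dim scale V M)"
    by (auto simp: has_quot_dim_def quot_dim_def)
  then show ?thesis using has_quot_dim_unique assms by blast
qed

text \<open>The bound provides a family of maximal cardinality among those independent modulo
  \<open>M\<close>. It must be a basis, since an \<open>x\<close> outside \<open>span B + M\<close>
  could be adjoined to it.\<close>

lemma has_quot_dim_exI:
  assumes M: "subspace M"
    and bound: "\<And>B. B \<subseteq> V \<Longrightarrow> indep_mod scale M B \<Longrightarrow> card B \<le> r"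
  shows "\<exists>n. has_quot_dim scale V M n"
proof -
  let ?P = "\<lambda>B. B \<subseteq> V \<and> indep_mod scale M B"
  have "?P {}" by (simp add: indep_mod_def independent_empty)
  then obtain B where B: "?P B" and max: "\<And>C. ?P C \<Longrightarrow> card C \<le> card B"
    \<comment> \<open>The maximum principle takes a strict bound, hence
      \<open>Suc r\<close>.\<close>
    using ex_has_greatest_nat[of ?P "{}" card "Suc r"] bound by (auto simp: less_Suc_eq_le)
  have fB: "finite B" and iB: "independent B" and sB: "span B \<inter> M \<subseteq> {0}"
    using B by (auto simp: indep_mod_def)
  have "\<exists>w\<in>span B. x - w \<in> M" if x: "x \<in> V" for x
  proof (rule ccontr)
    assume no: "\<not> (\<exists>w\<in>span B. x - w \<in> M)"
    then have xB: "x \<notin> span B" using subspace_0[OF M] by force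
    have "v = 0" if v: "v \<in> span (insert x B)" "v \<in> M" for v
    proof -
      obtain c where c: "v - scale c x \<in> span B"
        using v(1) by (auto simp: span_insert)
      have "c = 0"
      proof (rule ccontr)
        assume "c \<noteq> 0"
        \<comment> \<open>Solving for \<open>x\<close> would make it congruent modulo
          \<open>M\<close> to an element of \<open>span B\<close>, which \<open>no\<close>
          excludes.\<close>
        then have "x - scale (- inverse c) (v - scale c x) = scale (inverse c) v"
          by (simp add: scale_right_diff_distrib)
        then have "x - scale (- inverse c) (v - scale c x) \<in> M"
          using subspace_scale[OF M v(2)] by simp
        with no span_scale[OF c] show False by blast
      qed
      with c sB v(2) show "v = 0" by auto
    qed
    then have "indep_mod scale M (insert x B)"
      using fB iB xB by (auto simp: indep_mod_def independent_insert)
    with max[of "insert x B"] B x have "card (insert x B) \<le> card B" by simp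
    moreover have "x \<notin> B" using xB span_base by blast
    ultimately show False using fB by simp
  qed
  with B show ?thesis
    unfolding has_quot_dim_def quot_basis_iff[OF M] by blast
qed

text \<open>A basis of \<open>V\<close> modulo \<open>U\<close> together with a basis of
  \<open>W\<close> modulo \<open>V\<close> is a basis of \<open>W\<close> modulo
  \<open>U\<close>.\<close>

lemma has_quot_dim_chain:
  assumes U: "subspace U" and V: "subspace V" and W: "subspace W" and sub: "U \<subseteq> V" "V \<subseteq> W"
    and p: "has_quot_dim scale V U p" and q: "has_quot_dim scale W V q"
  shows "has_quot_dim scale W U (p + q)"
proof -
  obtain B C where B: "quot_basis scale V U B" "card B = p"
    and C: "quot_basis scale W V C" "card C = q"
    using p q by (auto simp: has_quot_dim_def)
  have B': "finite B" "B \<subseteq> V" "indep_mod scale U B" "\<forall>x\<in>V. \<exists>w\<in>span B. x - w \<in> U"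
    using B quot_basis_iff[OF U] by (auto simp: indep_mod_def)
  have C': "finite C" "C \<subseteq> W" "indep_mod scale V C" "\<forall>x\<in>W. \<exists>w\<in>span C. x - w \<in> V"
    using C quot_basis_iff[OF V] by (auto simp: indep_mod_def)
  have disj: "B \<inter> C = {}"
  proof (rule ccontr)
    assume "B \<inter> C \<noteq> {}"
    then obtain b where "b \<in> B" "b \<in> C" by blast
    moreover from this have "b = 0"
      using B'(2) C'(3) span_base[of b C] unfolding indep_mod_def by blast
    ultimately show False
      using C'(3) dependent_zero unfolding indep_mod_def by blast
  qed
  have "indep_mod scale U (B \<union> C)"
    unfolding indep_mod_iff[OF U]
  proof (intro conjI allI impI)
    show "finite (B \<union> C)" using B'(1) C'(1) by simp
    fix c assume c: "(\<Sum>b\<in>B \<union> C. scale (c b) b) \<in> U"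
    have split: "(\<Sum>b\<in>B \<union> C. scale (c b) b) = (\<Sum>b\<in>B. scale (c b) b) + (\<Sum>b\<in>C. scale (c b) b)"
      using B'(1) C'(1) disj by (intro sum.union_disjoint)
    \<comment> \<open>The part over \<open>B\<close> lies in \<open>V\<close>, hence so does the
      part over \<open>C\<close>. Independence modulo \<open>V\<close> removes the coefficients on
      \<open>C\<close> first; those on \<open>B\<close> then vanish by independence modulo
      \<open>U\<close>.\<close>
    have "(\<Sum>b\<in>B. scale (c b) b) \<in> V"
      using B'(2) by (intro subspace_sum[OF V] subspace_scale[OF V]) auto
    then have "(\<Sum>b\<in>B \<union> C. scale (c b) b) - (\<Sum>b\<in>B. scale (c b) b) \<in> V"
      using subspace_diff[OF V] c sub(1) by blast
    then have "(\<Sum>b\<in>C. scale (c b) b) \<in> V"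
      unfolding split by (simp only: add_diff_cancel_left')
    then have cC: "\<forall>b\<in>C. c b = 0"
      using C'(3) unfolding indep_mod_iff[OF V] by blast
    then have "(\<Sum>b\<in>B. scale (c b) b) \<in> U"
      using c split by simp
    then have "\<forall>b\<in>B. c b = 0"
      using B'(3) unfolding indep_mod_iff[OF U] by blast
    with cC show "\<forall>b\<in>B \<union> C. c b = 0" by blast
  qed
  moreover have "\<exists>w\<in>span (B \<union> C). x - w \<in> U" if x: "x \<in> W" for x
  proof -
    obtain w where w: "w \<in> span C" "x - w \<in> V" using C'(4) x by blast
    then obtain w' where w': "w' \<in> span B" "x - w - w' \<in> U" using B'(4) by blast
    have "w + w' \<in> span (B \<union> C)"
      using w(1) w'(1) span_mono[of C "B \<union> C"] span_mono[of B "B \<union> C"]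
      by (intro span_add) blast+
    then show ?thesis using w'(2) unfolding diff_diff_eq by blast
  qed
  ultimately have "quot_basis scale W U (B \<union> C)"
    unfolding quot_basis_iff[OF U] using B'(2) C'(2) sub by blast
  moreover have "card (B \<union> C) = p + q"
    using B(2) B'(1) C(2) C'(1) disj by (simp add: card_Un_disjoint)
  ultimately show ?thesis by (auto simp: has_quot_dim_def)
qed

text \<open>Both kinds of independent families, those in \<open>V\<close> modulo \<open>U\<close>
  and those in \<open>W\<close> modulo \<open>V\<close>, are also independent families in
  \<open>W\<close> modulo \<open>U\<close>. Hence \<open>r\<close> bounds their size.\<close>

lemma has_quot_dim_chain_ex:
  assumes U: "subspace U" and V: "subspace V" and sub: "U \<subseteq> V" "V \<subseteq> W"
    and r: "has_quot_dim scale W U r"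
  shows "\<exists>p. has_quot_dim scale V U p" "\<exists>q. has_quot_dim scale W V q"
proof -
  show "\<exists>p. has_quot_dim scale V U p"
    using sub by (intro has_quot_dim_exI[OF U, of _ r] indep_mod_card_le_dim[OF U r]) auto
  have "indep_mod scale U B" if "indep_mod scale V B" for B
    using that sub by (auto simp: indep_mod_def)
  then show "\<exists>q. has_quot_dim scale W V q"
    by (intro has_quot_dim_exI[OF V, of _ r] indep_mod_card_le_dim[OF U r]) auto
qed

section \<open>Ordinary dimension as dimension modulo the zero subspace\<close>

lemma quot_basis_zero_iff:
  assumes V: "subspace V"
  shows "quot_basis scale V {0} B \<longleftrightarrow> finite B \<and> independent B \<and> span B = V"
proof
  assume "quot_basis scale V {0} B"
  then have B: "B \<subseteq> V" "finite B" "independent B" "\<And>x. x \<in> V \<Longrightarrow> x \<in> span B"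
    unfolding quot_basis_iff[OF subspace_single_0] indep_mod_def by auto
  with span_minimal[OF B(1) V] show "finite B \<and> independent B \<and> span B = V" by blast
next
  assume B: "finite B \<and> independent B \<and> span B = V"
  moreover have "\<exists>w\<in>span B. x - w \<in> {0}" if "x \<in> V" for x
    using B that by (intro bexI[of _ x]) auto
  ultimately show "quot_basis scale V {0} B"
    unfolding quot_basis_iff[OF subspace_single_0] indep_mod_def using span_superset[of B] by blast
qed

lemma has_quot_dim_zero_iff:
  assumes V: "subspace V"
  shows "has_quot_dim scale V {0} n \<longleftrightarrow> finite_dim scale V \<and> dim V = n"
proof
  assume "has_quot_dim scale V {0} n"
  then obtain B where "finite B" "independent B" "span B = V" "card B = n"
    unfolding has_quot_dim_def quot_basis_zero_iff[OF V] by blast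
  moreover from this have "dim V = n"
    using dim_eq_card_independent[of B] dim_span[of B] by simp
  ultimately show "finite_dim scale V \<and> dim V = n"
    using span_superset[of B] unfolding finite_dim_def by blast
next
  assume *: "finite_dim scale V \<and> dim V = n"
  then obtain B where B: "finite B" "B \<subseteq> V" "V \<subseteq> span B"
    unfolding finite_dim_def by blast
  \<comment> \<open>\<open>finite_dim\<close> only supplies a finite spanning set, which is thinned
    out to a basis.\<close>
  obtain C where C: "C \<subseteq> B" "independent C" "B \<subseteq> span C"
    using maximal_independent_subset[of B] by blast
  have "V \<subseteq> span C"
    using B(3) span_minimal[OF C(3) subspace_span] by blast
  then have sC: "span C = V"
    using span_minimal[of C V] V B(2) C(1) by blast
  then have "card C = n"
    using * C(2) dim_eq_card_independent[of C] dim_span[of C] by simp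
  moreover have "finite C" using B(1) C(1) finite_subset by blast
  ultimately show "has_quot_dim scale V {0} n"
    unfolding has_quot_dim_def quot_basis_zero_iff[OF V] using C(2) sC by blast
qed

end

text \<open>The assumptions \<open>into\<close>, \<open>ker\<close> and \<open>surj\<close> say that
  \<open>f\<close> induces an isomorphism of \<open>V\<close> modulo \<open>M\<close> onto
  \<open>V'\<close> modulo \<open>M'\<close>. All comparisons of dimensions for the pair and the sum
  are instances of this.\<close>

lemma has_quot_dim_iso:
  assumes f: "Vector_Spaces.linear s1 s2 f"
    and V: "module.subspace s1 V" and M: "module.subspace s1 M" and M': "module.subspace s2 M'"
    and into: "\<And>x. x \<in> V \<Longrightarrow> f x \<in> V'"
    and ker: "\<And>x. x \<in> V \<Longrightarrow> f x \<in> M' \<longleftrightarrow> x \<in> M"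
    and surj: "\<And>y. y \<in> V' \<Longrightarrow> \<exists>x\<in>V. y - f x \<in> M'"
  shows "has_quot_dim s1 V M n \<longleftrightarrow> has_quot_dim s2 V' M' n"
proof -
  interpret f: Vector_Spaces.linear s1 s2 f by (rule f)
  have im: "indep_mod s2 M' (f ` B) \<and> card (f ` B) = card B"
    if B: "B \<subseteq> V" "indep_mod s1 M B" for B
  proof -
    have sp: "f.vs1.span B \<subseteq> V" by (rule f.vs1.span_minimal[OF B(1) V])
    have fin: "finite B" and ind: "f.vs1.independent B" and triv: "f.vs1.span B \<inter> M \<subseteq> {0}"
      using B(2) by (simp_all add: indep_mod_def)
    have z: "w = 0" if "w \<in> f.vs1.span B" "f w \<in> M'" for w
      using that(1) ker[of w] that(2) sp triv by (meson IntI singletonD subsetD)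
    have inj: "inj_on f (f.vs1.span B)"
      unfolding f.inj_on_iff_eq_0[OF f.vs1.subspace_span]
      using z f.vs2.subspace_0[OF M'] by metis
    have "f.vs2.span (f ` B) \<inter> M' \<subseteq> {0}"
    proof
      fix y assume "y \<in> f.vs2.span (f ` B) \<inter> M'"
      then obtain w where "w \<in> f.vs1.span B" "y = f w" "f w \<in> M'"
        by (auto simp: f.span_image)
      then show "y \<in> {0}" using z[of w] by (simp add: f.zero)
    qed
    then have "indep_mod s2 M' (f ` B)"
      unfolding indep_mod_def
      using fin f.independent_injective_image[OF ind inj] by blast
    moreover have "inj_on f B"
      by (rule inj_on_subset[OF inj f.vs1.span_superset])
    ultimately show ?thesis by (simp add: card_image)
  qed
  have fwd: "has_quot_dim s2 V' M' k" if k: "has_quot_dim s1 V M k" for k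
  proof -
    obtain B where B: "B \<subseteq> V" "indep_mod s1 M B" "card B = k"
      and span: "\<And>x. x \<in> V \<Longrightarrow> \<exists>w\<in>f.vs1.span B. x - w \<in> M"
      using k unfolding has_quot_dim_def f.vs1.quot_basis_iff[OF M] by blast
    have "\<exists>w\<in>f.vs2.span (f ` B). y - w \<in> M'" if y: "y \<in> V'" for y
    proof -
      obtain x where x: "x \<in> V" "y - f x \<in> M'" using surj y by blast
      obtain w where w: "w \<in> f.vs1.span B" "x - w \<in> M" using span x by blast
      have "w \<in> V" using w(1) f.vs1.span_minimal[OF B(1) V] by blast
      then have "f (x - w) \<in> M'"
        using ker[of "x - w"] w(2) f.vs1.subspace_diff[OF V x(1)] by blast
      then have "(y - f x) + f (x - w) \<in> M'"
        using f.vs2.subspace_add[OF M' x(2)] by blast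
      then have "y - f w \<in> M'" by (simp add: f.diff)
      with w(1) show ?thesis by (auto simp: f.span_image)
    qed
    then have "quot_basis s2 V' M' (f ` B)"
      unfolding f.vs2.quot_basis_iff[OF M'] using im[OF B(1,2)] B(1) into by blast
    with im[OF B(1,2)] B(3) show ?thesis unfolding has_quot_dim_def by blast
  qed
  \<comment> \<open>For the converse, existence of some dimension \<open>k\<close> suffices:
    \<open>fwd\<close> and uniqueness then force \<open>k = n\<close>.\<close>
  have "\<exists>k. has_quot_dim s1 V M k" if n: "has_quot_dim s2 V' M' n"
  proof (rule f.vs1.has_quot_dim_exI[OF M, of V n])
    fix B assume B: "B \<subseteq> V" "indep_mod s1 M B"
    then have "card (f ` B) \<le> n"
      using im[OF B] into B(1) by (intro f.vs2.indep_mod_card_le_dim[OF M' n]) auto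
    with im[OF B] show "card B \<le> n" by simp
  qed
  with fwd show ?thesis
    using f.vs2.has_quot_dim_unique[OF M'] by blast
qed


section \<open>The index of the sum\<close>

text \<open>The algebraic relations from which the dimensions are computed. The generalized inverse
  equations for \<open>S\<close> and \<open>T\<close> survive only modulo \<open>N\<close> and
  \<open>M\<close>, whereas those for \<open>T'\<close> and for the products of \<open>S'\<close>
  and \<open>T'\<close> are exact because these operators take values in complements. The assumption
  \<open>T'_in_N\<close> records the latter for \<open>T'\<close>.\<close>

locale partial_inverse_pair =
  S: Vector_Spaces.linear s1 s2 S + T: Vector_Spaces.linear s2 s1 T +
  S': Vector_Spaces.linear s2 s1 S' + T': Vector_Spaces.linear s1 s2 T'
  for s1 :: "'k::field \<Rightarrow> 'a::real_normed_vector \<Rightarrow> 'a" and s2 :: "'k \<Rightarrow> 'b::real_normed_vector \<Rightarrow> 'b"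
    and S :: "'a \<Rightarrow> 'b" and T :: "'b \<Rightarrow> 'a" and S' :: "'b \<Rightarrow> 'a" and T' :: "'a \<Rightarrow> 'b" +
  fixes M :: "'a set" and N :: "'b set"
  assumes M: "M = range (T \<circ> S)" and N: "N = range (S \<circ> T)"
    and S'_N: "y \<in> N \<Longrightarrow> S' y = 0" and T'_M: "x \<in> M \<Longrightarrow> T' x = 0"
    and SS'S: "S x - S (S' (S x)) \<in> N" and TT'T: "T y - T (T' (T y)) \<in> M"
    and T'TT': "T' (T (T' x)) = T' x"
    and S'T': "S' (T' x) = 0" and T'S': "T' (S' y) = 0"
    and T'_in_N: "T' x \<in> N \<Longrightarrow> T' x = 0"
    and M_fin: "finite_dim s1 M" and N_fin: "finite_dim s2 N"
begin

definition A :: "'a \<Rightarrow> 'b" where "A = (\<lambda>x. S x + T' x)"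

definition K :: "'a set" where "K = {x. S x \<in> N \<and> T' x = 0}"

sublocale A: Vector_Spaces.linear s1 s2 A
  by unfold_locales
    (simp_all add: A_def S.add T'.add S.scale T'.scale S.vs2.scale_right_distrib)

abbreviation "sub1 \<equiv> S.vs1.subspace"
abbreviation "sub2 \<equiv> S.vs2.subspace"

section \<open>The subspaces entering the dimension count\<close>

lemma sub_M: "sub1 M" and sub_N: "sub2 N"
proof -
  have "sub1 (T ` (S ` UNIV))"
    by (intro T.subspace_image S.subspace_image S.vs1.subspace_UNIV)
  then show "sub1 M" by (simp add: M image_comp)
  have "sub2 (S ` (T ` UNIV))"
    by (intro T.subspace_image S.subspace_image S.vs2.subspace_UNIV)
  then show "sub2 N" by (simp add: N image_comp)
qed

lemma M_I: "T (S x) \<in> M" and N_I: "S (T y) \<in> N"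
  by (auto simp: M N)

lemma S_M: "x \<in> M \<Longrightarrow> S x \<in> N" and T_N: "y \<in> N \<Longrightarrow> T y \<in> M"
  by (auto simp: M N)

lemma sub_nulls: "sub1 (null_space S)" "sub2 (null_space T)" "sub1 (null_space A)"
  using S.subspace_kernel T.subspace_kernel A.subspace_kernel by (auto simp: null_space_def)

lemma sub_ranges: "sub2 (range S)" "sub1 (range T)" "sub2 (range A)"
  using S.subspace_image[OF S.vs1.subspace_UNIV] T.subspace_image[OF S.vs2.subspace_UNIV]
    A.subspace_image[OF S.vs1.subspace_UNIV] by auto

lemma sub_inters:
  "sub1 (null_space S \<inter> range T)" "sub2 (null_space T \<inter> range S)" "sub2 (N \<inter> range A)"
  using S.vs1.subspace_inter[OF sub_nulls(1) sub_ranges(2)]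
    S.vs2.subspace_inter[OF sub_nulls(2) sub_ranges(1)]
    S.vs2.subspace_inter[OF sub_N sub_ranges(3)] by simp_all

lemma sub_K: "sub1 K"
  unfolding S.vs1.subspace_def K_def
  using S.vs2.subspace_def[of N] sub_N
  by (auto simp: S.add T'.add S.scale T'.scale S.zero T'.zero)

text \<open>Applying \<open>S'\<close> removes the summand \<open>T' x\<close> and annihilates
  \<open>N\<close>, so \<open>S' (S x) = 0\<close> and \<open>SS'S\<close> puts \<open>S x\<close>
  into \<open>N\<close>. Then \<open>T' x = A x - S x\<close> lies in \<open>N\<close> too, and so
  vanishes.\<close>

lemma A_in_N_iff: "A x \<in> N \<longleftrightarrow> x \<in> K"
proof
  assume *: "A x \<in> N"
  have "S' (S x) = S' (A x)" by (simp add: A_def S'.add S'T')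
  also have "\<dots> = 0" using * by (rule S'_N)
  finally have "S x \<in> N" using SS'S[of x] by (simp add: S.zero)
  moreover from this have "T' x \<in> N"
    using * S.vs2.subspace_diff[OF sub_N, of "A x" "S x"] by (simp add: A_def)
  ultimately show "x \<in> K" using T'_in_N by (simp add: K_def)
qed (simp add: A_def K_def)

lemma null_A_subset_K: "null_space A \<subseteq> K"
proof
  fix x assume "x \<in> null_space A"
  then have "A x \<in> N" using S.vs2.subspace_0[OF sub_N] by (simp add: null_space_def)
  then show "x \<in> K" by (simp only: A_in_N_iff)
qed

lemma M_subset_K: "M \<subseteq> K"
  using S_M T'_M by (auto simp: K_def)

text \<open>The isomorphism is induced by \<open>x \<mapsto> x - T (T' x)\<close>, which removes the
  part of \<open>x\<close> seen by \<open>T'\<close>.\<close>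

lemma quot_dim_null_S:
  "has_quot_dim s1 (null_space S) (null_space S \<inter> range T) a \<longleftrightarrow> has_quot_dim s1 K M a"
proof (rule has_quot_dim_iso)
  show "Vector_Spaces.linear s1 s1 (\<lambda>x. x - T (T' x))"
    by unfold_locales (auto simp: T.add T'.add T.scale T'.scale algebra_simps)
  show "sub1 (null_space S \<inter> range T)" "sub1 (null_space S)"
    using sub_nulls sub_ranges sub_inters by auto
  show "sub1 M" by (rule sub_M)
  \<comment> \<open>\<open>T'\<close> annihilates the image by \<open>T'TT'\<close>, and
    \<open>S\<close> maps it to \<open>- S (T (T' x))\<close>, an element of
    \<open>N\<close>.\<close>
  show "x - T (T' x) \<in> K" if "x \<in> null_space S" for x
    using that S.vs2.subspace_neg[OF sub_N N_I]
    by (auto simp: K_def null_space_def S.diff T'.diff T'TT')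
  show "x - T (T' x) \<in> M \<longleftrightarrow> x \<in> null_space S \<inter> range T" if x: "x \<in> null_space S" for x
  proof
    assume "x - T (T' x) \<in> M"
    then obtain u where "x - T (T' x) = T (S u)" by (auto simp: M)
    then have "x = T (S u + T' x)" by (simp add: T.add algebra_simps)
    with x show "x \<in> null_space S \<inter> range T" by blast
  qed (use TT'T in auto)
  show "\<exists>x\<in>null_space S. k - (x - T (T' x)) \<in> M" if k: "k \<in> K" for k
  proof -
    have "S k \<in> N" using k by (simp add: K_def)
    then obtain y where y: "S k = S (T y)" by (auto simp: N)
    \<comment> \<open>The preimage of \<open>k\<close> is \<open>k - T y\<close>, which lies in the
      null space of \<open>S\<close> by the choice of \<open>y\<close>. As \<open>T' k = 0\<close>,
      the error is exactly the defect of \<open>TT'T\<close> at \<open>y\<close>.\<close>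
    have "k - ((k - T y) - T (T' (k - T y))) = T y - T (T' (T y))"
      using k by (simp add: K_def T'.diff T.diff T.neg)
    moreover have "k - T y \<in> null_space S"
      using y by (simp add: null_space_def S.diff)
    ultimately show ?thesis using TT'T by metis
  qed
qed

definition R :: "'b set" where "R = {y + w |y w. y \<in> range A \<and> w \<in> N}"

lemma sub_R: "sub2 R"
  unfolding R_def by (rule S.vs2.subspace_sums[OF sub_ranges(3) sub_N])

lemma range_A_subset_R: "range A \<subseteq> R"
  unfolding R_def using S.vs2.subspace_0[OF sub_N] by force

lemma range_S_subset_R: "range S \<subseteq> R"
proof safe
  fix x
  \<comment> \<open>On the range of \<open>S'\<close> the operators \<open>A\<close> and
    \<open>S\<close> agree, since \<open>T'S'\<close> is zero.\<close>
  have "S x = A (S' (S x)) + (S x - S (S' (S x)))"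
    by (simp add: A_def T'S')
  then show "S x \<in> R" unfolding R_def using SS'S by blast
qed

lemma range_T'_subset_R: "range T' \<subseteq> R"
proof safe
  fix x
  \<comment> \<open>Evaluating \<open>A\<close> at \<open>T (T' x)\<close> reproduces
    \<open>T' x\<close> up to an element of \<open>N\<close>.\<close>
  have "T' x = A (T (T' x)) + - S (T (T' x))"
    by (simp add: A_def T'TT')
  then show "T' x \<in> R" unfolding R_def using S.vs2.subspace_neg[OF sub_N N_I] by blast
qed

text \<open>The inclusion of the null space of \<open>T\<close> into the whole space induces the
  isomorphism.\<close>

lemma quot_dim_null_T:
  "has_quot_dim s2 (null_space T) (null_space T \<inter> range S) c \<longleftrightarrow> has_quot_dim s2 UNIV R c"
proof (rule has_quot_dim_iso)
  show "Vector_Spaces.linear s2 s2 (\<lambda>x. x)"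
    by unfold_locales auto
  show "sub2 (null_space T \<inter> range S)" "sub2 (null_space T)"
    using sub_nulls sub_ranges sub_inters by auto
  show "sub2 R" by (rule sub_R)
  show "y \<in> R \<longleftrightarrow> y \<in> null_space T \<inter> range S" if y: "y \<in> null_space T" for y
  proof
    assume "y \<in> R"
    then obtain x w where xw: "y = A x + w" "w \<in> N" by (auto simp: R_def)
    \<comment> \<open>Applying \<open>T\<close> to \<open>y\<close> shows that
      \<open>T (T' x)\<close> is in \<open>M\<close>. There \<open>T'\<close> vanishes, so
      \<open>T' x = T' (T (T' x)) = 0\<close> and only elements of the range of \<open>S\<close>
      remain.\<close>
    then have "T (S x) + T (T' x) + T w = 0"
      using y by (simp add: null_space_def A_def T.add)
    then have "T (T' x) = - (T (S x) + T w)"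
      by (metis add.assoc add.commute eq_neg_iff_add_eq_0)
    also have "\<dots> \<in> M"
      using M_I T_N[OF xw(2)] by (intro S.vs1.subspace_neg[OF sub_M] S.vs1.subspace_add[OF sub_M])
    finally have "T' x = 0" using T'_M[of "T (T' x)"] T'TT' by simp
    moreover obtain u where "w = S (T u)" using xw(2) by (auto simp: N)
    ultimately have "y = S (x + T u)" using xw(1) by (simp add: A_def S.add)
    with y show "y \<in> null_space T \<inter> range S" by blast
  qed (use range_S_subset_R in auto)
  show "\<exists>x\<in>null_space T. y - x \<in> R" for y
  proof -
    obtain u where u: "T y - T (T' (T y)) = T (S u)" using TT'T[of y] by (auto simp: M)
    \<comment> \<open>Subtracting \<open>T' (T y)\<close> makes \<open>T\<close> of the result an
      element \<open>T (S u)\<close> of \<open>M\<close>; subtracting \<open>S u\<close> as well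
      cancels it. Both corrections lie in \<open>R\<close>.\<close>
    have "y - T' (T y) - S u \<in> null_space T"
      using u by (simp add: null_space_def T.diff)
    moreover have "T' (T y) + S u \<in> R"
      using range_S_subset_R range_T'_subset_R by (intro S.vs2.subspace_add[OF sub_R]) auto
    then have "y - (y - T' (T y) - S u) \<in> R" by (simp add: algebra_simps)
    ultimately show ?thesis by blast
  qed
qed auto

text \<open>Second isomorphism theorem for \<open>N\<close> and the range of
  \<open>A\<close>.\<close>

lemma quot_dim_R:
  "has_quot_dim s2 N (N \<inter> range A) l \<longleftrightarrow> has_quot_dim s2 R (range A) l"
proof (rule has_quot_dim_iso)
  show "Vector_Spaces.linear s2 s2 (\<lambda>x. x)"
    by unfold_locales auto
  show "sub2 N" "sub2 (N \<inter> range A)" "sub2 (range A)"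
    using sub_N sub_ranges sub_inters by auto
  show "x \<in> R" if "x \<in> N" for x
    using that S.vs2.subspace_0[OF sub_ranges(3)] unfolding R_def by force
  show "\<exists>x\<in>N. y - x \<in> range A" if "y \<in> R" for y
    using that by (force simp: R_def)
qed auto

text \<open>First isomorphism theorem for \<open>A\<close> restricted to \<open>K\<close>, the
  preimage of \<open>N\<close>.\<close>

lemma quot_dim_K:
  "has_quot_dim s1 K (null_space A) k \<longleftrightarrow> has_quot_dim s2 (N \<inter> range A) {0} k"
proof (rule has_quot_dim_iso)
  show "Vector_Spaces.linear s1 s2 A" by (rule A.linear_axioms)
  show "sub1 K" "sub1 (null_space A)" "sub2 {0}"
    using sub_K sub_nulls by (auto simp: S.vs2.subspace_single_0)
qed (auto simp: A_in_N_iff[symmetric] null_space_def)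

text \<open>Here \<open>S\<close> restricted to the range of \<open>T\<close> has image
  \<open>N\<close>; this identifies the second term of the pair index with the dimension of
  \<open>N\<close>.\<close>

lemma quot_dim_range_T:
  "has_quot_dim s1 (range T) (null_space S \<inter> range T) b \<longleftrightarrow> has_quot_dim s2 N {0} b"
proof (rule has_quot_dim_iso)
  show "Vector_Spaces.linear s1 s2 S" by (rule S.linear_axioms)
  show "sub1 (range T)" "sub1 (null_space S \<inter> range T)" "sub2 {0}"
    using sub_nulls sub_ranges sub_inters by auto
qed (auto simp: null_space_def N)

lemma quot_dim_range_S:
  "has_quot_dim s2 (range S) (null_space T \<inter> range S) d \<longleftrightarrow> has_quot_dim s1 M {0} d"
proof (rule has_quot_dim_iso)
  show "Vector_Spaces.linear s2 s1 T" by (rule T.linear_axioms)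
  show "sub2 (range S)" "sub2 (null_space T \<inter> range S)" "sub1 {0}"
    using sub_nulls sub_ranges sub_inters by auto
qed (auto simp: null_space_def M)

text \<open>The chain from zero through \<open>N \<inter> range A\<close> to \<open>N\<close> splits
  the dimension of \<open>N\<close> into two parts. One measures \<open>K\<close> over the null
  space of \<open>A\<close>, the other \<open>R\<close> over the range of \<open>A\<close>.\<close>

lemma dims_of_finite:
  obtains k l where
    "has_quot_dim s1 M {0} (S.vs1.dim M)" "has_quot_dim s2 N {0} (S.vs2.dim N)"
    "has_quot_dim s1 K (null_space A) k" "has_quot_dim s2 R (range A) l" "S.vs2.dim N = k + l"
proof -
  have M: "has_quot_dim s1 M {0} (S.vs1.dim M)" and N: "has_quot_dim s2 N {0} (S.vs2.dim N)"
    using M_fin N_fin sub_M sub_N S.vs1.has_quot_dim_zero_iff S.vs2.has_quot_dim_zero_iff by auto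
  have sub: "sub2 (N \<inter> range A)" "{0} \<subseteq> N \<inter> range A" "N \<inter> range A \<subseteq> N"
    using sub_inters(3) S.vs2.subspace_0[OF sub_inters(3)] by auto
  obtain k l where kl: "has_quot_dim s2 (N \<inter> range A) {0} k" "has_quot_dim s2 N (N \<inter> range A) l"
    using S.vs2.has_quot_dim_chain_ex[OF S.vs2.subspace_single_0 sub N] by auto
  then have "has_quot_dim s2 N {0} (k + l)"
    using S.vs2.has_quot_dim_chain[OF S.vs2.subspace_single_0 sub(1) sub_N sub(2,3)] by blast
  then have "S.vs2.dim N = k + l"
    using N S.vs2.has_quot_dim_unique S.vs2.subspace_single_0 by blast
  with M N kl that show ?thesis by (simp add: quot_dim_K quot_dim_R)
qed

text \<open>Both \<open>M\<close> and the quotient of \<open>K\<close> by the null space of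
  \<open>A\<close> are finite dimensional, so finiteness passes from the null space of
  \<open>A\<close> to \<open>K\<close> and on to \<open>K\<close> modulo \<open>M\<close>.\<close>

lemma finite_dim_null_A_iff:
  "finite_dim s1 (null_space A) \<longleftrightarrow> quot_finite_dim s1 (null_space S) (null_space S \<inter> range T)"
proof -
  obtain k where k: "has_quot_dim s1 K (null_space A) k" and
    m: "has_quot_dim s1 M {0} (S.vs1.dim M)"
    using dims_of_finite by blast
  have 0: "sub1 {0}" "{0} \<subseteq> M" "{0} \<subseteq> null_space A"
    using S.vs1.subspace_0 sub_M sub_nulls by auto
  have "finite_dim s1 (null_space A) \<longleftrightarrow> (\<exists>n. has_quot_dim s1 (null_space A) {0} n)"
    using S.vs1.has_quot_dim_zero_iff[OF sub_nulls(3)] by blast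
  also have "\<dots> \<longleftrightarrow> (\<exists>n. has_quot_dim s1 K {0} n)"
    using S.vs1.has_quot_dim_chain[OF 0(1) sub_nulls(3) sub_K 0(3) null_A_subset_K _ k]
      S.vs1.has_quot_dim_chain_ex(1)[OF 0(1) sub_nulls(3) 0(3) null_A_subset_K] by blast
  also have "\<dots> \<longleftrightarrow> (\<exists>n. has_quot_dim s1 K M n)"
    using S.vs1.has_quot_dim_chain[OF 0(1) sub_M sub_K 0(2) M_subset_K m]
      S.vs1.has_quot_dim_chain_ex(2)[OF 0(1) sub_M 0(2) M_subset_K] by blast
  finally show ?thesis by (simp add: quot_finite_dim_iff quot_dim_null_S)
qed

lemma quot_finite_dim_range_A_iff:
  "quot_finite_dim s2 UNIV (range A) \<longleftrightarrow> quot_finite_dim s2 (null_space T) (null_space T \<inter> range S)"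
proof -
  obtain l where l: "has_quot_dim s2 R (range A) l" using dims_of_finite by blast
  have "(\<exists>n. has_quot_dim s2 UNIV (range A) n) \<longleftrightarrow> (\<exists>n. has_quot_dim s2 UNIV R n)"
    using S.vs2.has_quot_dim_chain[OF sub_ranges(3) sub_R S.vs2.subspace_UNIV range_A_subset_R _ l]
      S.vs2.has_quot_dim_chain_ex(2)[OF sub_ranges(3) sub_R range_A_subset_R] by blast
  then show ?thesis by (simp add: quot_finite_dim_iff quot_dim_null_T)
qed

text \<open>Computing the dimension of \<open>K\<close> through \<open>M\<close> and through the
  null space of \<open>A\<close> gives equation \<open>1\<close>; the codimension of the range of
  \<open>A\<close> is \<open>l + c\<close>. The unknowns \<open>k\<close> and \<open>l\<close> enter
  the index only through \<open>k + l\<close>, the dimension of \<open>N\<close>.\<close>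

lemma fredholm_index_A:
  assumes "quot_finite_dim s1 (null_space S) (null_space S \<inter> range T)"
    and "quot_finite_dim s2 (null_space T) (null_space T \<inter> range S)"
  shows "fredholm_index s1 s2 A = fredholm_pair_index s1 s2 S T"
proof -
  obtain k l where m: "has_quot_dim s1 M {0} (S.vs1.dim M)" and n: "has_quot_dim s2 N {0} (S.vs2.dim N)"
    and k: "has_quot_dim s1 K (null_space A) k" and l: "has_quot_dim s2 R (range A) l"
    and kl: "S.vs2.dim N = k + l"
    using dims_of_finite by blast
  obtain a c where a: "has_quot_dim s1 (null_space S) (null_space S \<inter> range T) a"
    and c: "has_quot_dim s2 (null_space T) (null_space T \<inter> range S) c"
    using assms by (auto simp: quot_finite_dim_iff)
  have 0: "sub1 {0}" "{0} \<subseteq> M" "{0} \<subseteq> null_space A"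
    using S.vs1.subspace_0 sub_M sub_nulls by auto
  have null: "has_quot_dim s1 (null_space A) {0} (S.vs1.dim (null_space A))"
    using finite_dim_null_A_iff assms(1) S.vs1.has_quot_dim_zero_iff[OF sub_nulls(3)] by blast
  have "has_quot_dim s1 K {0} (S.vs1.dim M + a)"
    using S.vs1.has_quot_dim_chain[OF 0(1) sub_M sub_K 0(2) M_subset_K m] a
    by (simp add: quot_dim_null_S)
  moreover have "has_quot_dim s1 K {0} (S.vs1.dim (null_space A) + k)"
    using S.vs1.has_quot_dim_chain[OF 0(1) sub_nulls(3) sub_K 0(3) null_A_subset_K null k] .
  ultimately have 1: "S.vs1.dim M + a = S.vs1.dim (null_space A) + k"
    using S.vs1.has_quot_dim_unique[OF 0(1)] by blast
  have "has_quot_dim s2 UNIV (range A) (l + c)"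
    using S.vs2.has_quot_dim_chain[OF sub_ranges(3) sub_R S.vs2.subspace_UNIV range_A_subset_R _ l] c
    by (simp add: quot_dim_null_T)
  then have 2: "quot_dim s2 UNIV (range A) = l + c"
    by (rule S.vs2.quot_dim_eq[OF sub_ranges(3)])
  have "fredholm_pair_index s1 s2 S T = int a - int (S.vs2.dim N) - int c + int (S.vs1.dim M)"
    unfolding fredholm_pair_index_def
    using S.vs1.quot_dim_eq[OF sub_inters(1)] S.vs2.quot_dim_eq[OF sub_inters(2)] a c m n
    by (simp add: quot_dim_range_T quot_dim_range_S)
  then show ?thesis
    unfolding fredholm_index_def 2 using 1 kl by linarith
qed

lemma finite_dim_pair:
  "quot_finite_dim s1 (range T) (null_space S \<inter> range T)"
  "quot_finite_dim s2 (range S) (null_space T \<inter> range S)"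
  using dims_of_finite
  by (auto simp: quot_finite_dim_iff quot_dim_range_T quot_dim_range_S)

end

section \<open>Boundedness of the extension\<close>

context banach_over
begin

lemma bounded_linear_scale_left: "bounded_linear (\<lambda>c. scale c b)"
proof (rule bounded_linear_intro)
  fix c d :: 'k and r :: real
  show "scale (c + d) b = scale c b + scale d b" by (rule scale_left_distrib)
  show "scale (r *\<^sub>R c) b = r *\<^sub>R scale c b"
    by (simp add: scaleR_conv_of_real scale_of_real flip: scale_scale)
  show "norm (scale c b) \<le> norm c * norm b" by (simp add: norm_scale)
qed

text \<open>Take for \<open>e\<close> the radius of a ball around \<open>b\<close> that misses
  \<open>Y\<close>. For nonzero \<open>c\<close>, scaling by \<open>- inverse c\<close> turns
  \<open>y + scale c b\<close> into the difference of a point of \<open>Y\<close> and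
  \<open>b\<close>.\<close>

lemma norm_add_scale_ge:
  assumes Y: "subspace Y" "closed Y" and b: "b \<notin> Y"
  obtains e where "e > 0" "\<And>y c. y \<in> Y \<Longrightarrow> norm c * e \<le> norm (y + scale c b)"
proof -
  have "open (- Y)" "b \<in> - Y" using Y b by (auto simp: open_Compl)
  then obtain e where e: "e > 0" "\<And>y. dist y b < e \<Longrightarrow> y \<in> - Y"
    unfolding open_dist by blast
  have "norm c * e \<le> norm (y + scale c b)" if y: "y \<in> Y" for y c
  proof (cases "c = 0")
    case False
    define z where "z = scale (- inverse c) y"
    have "z \<in> Y" unfolding z_def by (rule subspace_scale[OF Y(1) y])
    then have "e \<le> dist z b" using e(2)[of z] by force
    moreover have "z - b = scale (- inverse c) (y + scale c b)"
      using False by (simp add: z_def scale_right_distrib)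
    then have "dist z b = norm (y + scale c b) / norm c"
      by (simp add: dist_norm norm_scale norm_inverse divide_inverse mult.commute del: scale_minus_left)
    ultimately show ?thesis using False by (simp add: field_simps)
  qed simp
  with e(1) that show ?thesis by blast
qed

text \<open>The preceding estimate makes the coefficients of a convergent sequence Cauchy. They
  converge because the scalar field is complete, and then the components in \<open>Y\<close>
  converge as well.\<close>

lemma closed_add_line:
  assumes Y: "subspace Y" "closed Y" and b: "b \<notin> Y"
  shows "closed {y + scale c b |y c. y \<in> Y}" (is "closed ?Z")
proof -
  obtain e where e: "e > 0" "\<And>y c. y \<in> Y \<Longrightarrow> norm c * e \<le> norm (y + scale c b)"
    using norm_add_scale_ge[OF Y b] by blast
  have "l \<in> ?Z" if x: "\<forall>n. x n \<in> ?Z" "x \<longlonglongrightarrow> l" for x l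
  proof -
    obtain y c where yc: "\<And>n. x n = y n + scale (c n) b" "\<And>n. y n \<in> Y"
      using x(1) by simp metis
    have "Cauchy c"
    proof (rule metric_CauchyI)
      fix d :: real assume "d > 0"
      then have "d * e > 0" using e(1) by simp
      then obtain n0 where n0: "\<And>m n. m \<ge> n0 \<Longrightarrow> n \<ge> n0 \<Longrightarrow> dist (x m) (x n) < d * e"
        using LIMSEQ_imp_Cauchy[OF x(2)] unfolding Cauchy_def by meson
      have "dist (c m) (c n) < d" if mn: "m \<ge> n0" "n \<ge> n0" for m n
      proof -
        have "norm (c m - c n) * e \<le> norm ((y m - y n) + scale (c m - c n) b)"
          using yc(2) by (intro e(2) subspace_diff[OF Y(1)])
        also have "(y m - y n) + scale (c m - c n) b = x m - x n"
          by (simp add: yc(1) scale_left_diff_distrib)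
        also have "norm \<dots> < d * e" using n0[OF mn] by (simp add: dist_norm)
        finally show ?thesis using e(1) by (simp add: dist_norm)
      qed
      then show "\<exists>N. \<forall>m\<ge>N. \<forall>n\<ge>N. dist (c m) (c n) < d" by blast
    qed
    then obtain c0 where "c \<longlonglongrightarrow> c0"
      using Cauchy_convergent_iff convergent_def by blast
    then have "(\<lambda>n. scale (c n) b) \<longlonglongrightarrow> scale c0 b"
      by (rule bounded_linear.tendsto[OF bounded_linear_scale_left])
    with x(2) have "(\<lambda>n. x n - scale (c n) b) \<longlonglongrightarrow> l - scale c0 b"
      by (rule tendsto_diff)
    then have "l - scale c0 b \<in> Y"
      by (rule closed_sequentially[OF Y(2), rotated]) (simp add: yc)
    moreover have "l = (l - scale c0 b) + scale c0 b" by simp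
    ultimately show ?thesis by blast
  qed
  then show ?thesis unfolding closed_sequential_limits by blast
qed

text \<open>The projection onto \<open>Y\<close> along \<open>span B\<close> is bounded. The
  induction leaves \<open>Y\<close> arbitrary, because adjoining \<open>b\<close> to
  \<open>B\<close> is handled by enlarging \<open>Y\<close> by the line through
  \<open>b\<close>.\<close>

lemma norm_le_add_span:
  assumes "finite B" and "subspace Y" "closed Y" "span B \<inter> Y \<subseteq> {0}"
  shows "\<exists>C>0. \<forall>y\<in>Y. \<forall>w\<in>span B. norm y \<le> C * norm (y + w)"
  using assms
proof (induction B arbitrary: Y)
  case empty
  then show ?case by (intro exI[of _ 1]) simp
next
  case (insert b B)
  have sB: "span B \<subseteq> span (insert b B)" by (rule span_mono) blast
  show ?case
  proof (cases "b \<in> Y")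
    case True
    have "b \<in> span (insert b B)" by (rule span_base) simp
    with True insert.prems have "b = 0" by blast
    with insert sB show ?thesis by (simp add: span_insert_0)
  next
    case False
    define Z where "Z = {y + scale c b |y c. y \<in> Y}"
    have sub_Z: "subspace Z"
    proof -
      have "Z = {x + y |x y. x \<in> Y \<and> y \<in> span {b}}"
        by (auto simp: Z_def span_singleton)
      then show ?thesis
        using subspace_sums[OF insert.prems(1) subspace_span[of "{b}"]] by simp
    qed
    show ?thesis
    proof (cases "b \<in> span B")
      case True
      then have "span (insert b B) = span B" by (rule span_redundant)
      with insert show ?thesis by simp
    next
      case bB: False
      \<comment> \<open>The larger subspace \<open>Z\<close> still meets \<open>span B\<close>
        trivially, so the induction hypothesis applies to it.\<close>
      have "v = 0" if v: "v \<in> span B" "v \<in> Z" for v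
      proof -
        obtain y c where y: "v = y + scale c b" "y \<in> Y" using v(2) by (auto simp: Z_def)
        have "y = v - scale c b" using y(1) by simp
        also have "\<dots> \<in> span (insert b B)"
          using v(1) sB by (intro span_diff span_scale) (auto intro: span_base)
        finally have "y = 0" using y(2) insert.prems(3) by blast
        then have "scale c b \<in> span B" using y(1) v(1) by simp
        then have "c = 0"
          using bB span_scale[of "scale c b" B "inverse c"] by (cases "c = 0") auto
        with y(1) \<open>y = 0\<close> show "v = 0" by simp
      qed
      then obtain C where C: "C > 0" "\<And>z w. z \<in> Z \<Longrightarrow> w \<in> span B \<Longrightarrow> norm z \<le> C * norm (z + w)"
        using insert.IH[OF sub_Z] closed_add_line[OF insert.prems(1,2) False] unfolding Z_def by blast
      obtain e where e: "e > 0" "\<And>y c. y \<in> Y \<Longrightarrow> norm c * e \<le> norm (y + scale c b)"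
        using norm_add_scale_ge[OF insert.prems(1,2) False] by blast
      define D where "D = 1 + norm b / e"
      have D: "norm y \<le> D * norm (y + scale c b)" if y: "y \<in> Y" for y c
      proof -
        have "norm y \<le> norm (y + scale c b) + norm c * norm b"
          using norm_triangle_ineq4[of "y + scale c b" "scale c b"] by (simp add: norm_scale)
        also have "norm c * norm b \<le> norm (y + scale c b) / e * norm b"
          using e(2)[OF y, of c] e(1) by (intro mult_right_mono) (auto simp: field_simps)
        finally show ?thesis by (simp add: D_def algebra_simps)
      qed
      have "D > 0" using e(1) by (simp add: D_def add_pos_nonneg)
      \<comment> \<open>The projection factors through \<open>Z\<close>: \<open>C\<close> bounds the
        step onto \<open>Z\<close> along \<open>span B\<close>, and \<open>D\<close> the step from
        \<open>Z\<close> onto \<open>Y\<close> along \<open>b\<close>.\<close>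
      have "norm y \<le> D * C * norm (y + w)" if y: "y \<in> Y" and w: "w \<in> span (insert b B)" for y w
      proof -
        obtain c where c: "w - scale c b \<in> span B" using w by (auto simp: span_insert)
        have "norm y \<le> D * norm (y + scale c b)" by (rule D[OF y])
        also have "norm (y + scale c b) \<le> C * norm (y + scale c b + (w - scale c b))"
          using y c by (intro C(2)) (auto simp: Z_def)
        finally show ?thesis using \<open>D > 0\<close> by (simp add: mult.assoc)
      qed
      with \<open>D > 0\<close> C(1) show ?thesis by (intro exI[of _ "D * C"]) simp
    qed
  qed
qed

end

section \<open>Operations on cosets and representatives in a complement\<close>

context vector_space
begin

lemma quot_add_quot_map:
  assumes "subspace M"
  shows "quot_add (quot_map M x) (quot_map M y) = quot_map M (x + y)"
proof (intro equalityI subsetI)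
  fix z assume "z \<in> quot_add (quot_map M x) (quot_map M y)"
  then obtain m n where "z = (x + m) + (y + n)" "m \<in> M" "n \<in> M"
    by (auto simp: quot_add_def quot_map_def)
  moreover from this have "z = (x + y) + (m + n)" by simp
  ultimately show "z \<in> quot_map M (x + y)"
    using subspace_add[OF assms] unfolding quot_map_def by blast
next
  fix z assume "z \<in> quot_map M (x + y)"
  then obtain m where "z = (x + m) + (y + 0)" "m \<in> M"
    by (auto simp: quot_map_def)
  then show "z \<in> quot_add (quot_map M x) (quot_map M y)"
    using subspace_0[OF assms] unfolding quot_add_def quot_map_def by blast
qed

lemma quot_scale_quot_map:
  assumes "subspace M"
  shows "quot_scale scale M c (quot_map M x) = quot_map M (scale c x)"
proof (intro equalityI subsetI)
  fix z assume "z \<in> quot_scale scale M c (quot_map M x)"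
  then obtain m n where "z = scale c (x + m) + n" "m \<in> M" "n \<in> M"
    by (auto simp: quot_scale_def quot_map_def)
  moreover from this have "z = scale c x + (scale c m + n)" by (simp add: scale_right_distrib)
  ultimately show "z \<in> quot_map M (scale c x)"
    using subspace_add[OF assms] subspace_scale[OF assms] unfolding quot_map_def by blast
next
  fix z assume "z \<in> quot_map M (scale c x)"
  then obtain m where "z = scale c (x + 0) + m" "m \<in> M"
    by (auto simp: quot_map_def)
  then show "z \<in> quot_scale scale M c (quot_map M x)"
    using subspace_0[OF assms] unfolding quot_scale_def quot_map_def by blast
qed

end

context banach_over
begin

text \<open>This turns equations between cosets into exact equations for operators with values in a
  complement.\<close>

lemma closed_complement_unique:
  assumes "subspace N" "closed_complement scale N Y" "x \<in> Y" "y \<in> Y" "x - y \<in> N"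
  shows "x = y"
proof -
  have "x - y \<in> Y" using assms(2-4) subspace_diff by (auto simp: closed_complement_def)
  with assms(2,5) have "x - y \<in> {0}" unfolding closed_complement_def by blast
  then show ?thesis by simp
qed

lemma extension_op:
  assumes N: "subspace N" and Y: "closed_complement scale N Y"
    and B: "B (quot_map M x) \<in> quot_space N"
  shows "extension_op M N Y B x \<in> Y"
    and "quot_map N (extension_op M N Y B x) = B (quot_map M x)"
proof -
  have inj: "inj_on (quot_map N) Y"
    using closed_complement_unique[OF N Y] by (auto simp: inj_on_def quot_map_eq_iff[OF N])
  obtain z where z: "B (quot_map M x) = quot_map N z" using B by (auto simp: quot_space_def)
  obtain m y where "m \<in> N" "y \<in> Y" "z = m + y"
    using Y unfolding closed_complement_def by blast
  then have *: "B (quot_map M x) \<in> quot_map N ` Y"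
    unfolding z by (intro image_eqI[of _ _ y]) (auto simp: quot_map_eq_iff[OF N])
  show "extension_op M N Y B x \<in> Y"
    unfolding extension_op_def by (rule the_inv_into_into[OF inj * subset_refl])
  show "quot_map N (extension_op M N Y B x) = B (quot_map M x)"
    unfolding extension_op_def by (rule f_the_inv_into_f[OF inj *])
qed

end

lemma quot_norm_le:
  assumes "0 \<in> M"
  shows "quot_norm (quot_map M x) \<le> norm x"
  unfolding quot_norm_def
proof (rule cINF_lower)
  show "bdd_below (norm ` quot_map M x)" by (rule bdd_belowI2[of _ 0]) simp
  show "x \<in> quot_map M x" using assms by (force simp: quot_map_def)
qed

lemma quot_norm_ge:
  assumes "0 \<in> M" "\<And>m. m \<in> M \<Longrightarrow> r \<le> norm (x + m)"
  shows "r \<le> quot_norm (quot_map M x)"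
  unfolding quot_norm_def
  by (rule cINF_greatest) (use assms in \<open>auto simp: quot_map_def\<close>)

text \<open>Linearity holds because \<open>extension_op\<close> picks the only representative in
  \<open>Y\<^sub>0\<close>. The norm of that representative is controlled by the quotient norm of
  its coset, since the projection onto \<open>Y\<^sub>0\<close> along the finite dimensional
  \<open>N\<close> is bounded.\<close>

lemma bounded_extension_op:
  assumes X: "banach_over sX" and Y: "banach_over sY"
    and M: "module.subspace sX M" and N: "module.subspace sY N" "finite_dim sY N"
    and Y\<^sub>0: "closed_complement sY N Y\<^sub>0"
    and B: "quot_bounded_op sX M sY N B"
  shows "bounded_op sX sY (extension_op M N Y\<^sub>0 B)"
proof -
  interpret X: banach_over sX by (rule X)
  interpret Y: banach_over sY by (rule Y)
  let ?E = "extension_op M N Y\<^sub>0 B"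
  have Bq: "B (quot_map M x) \<in> quot_space N"
    and B_add: "B (quot_map M (x + y)) = quot_add (B (quot_map M x)) (B (quot_map M y))"
    and B_scale: "B (quot_map M (sX c x)) = quot_scale sY N c (B (quot_map M x))" for x y c
    using B by (auto simp: quot_bounded_op_def quot_space_def
        simp flip: X.quot_add_quot_map[OF M] X.quot_scale_quot_map[OF M])
  obtain L where L: "\<And>x. quot_norm (B (quot_map M x)) \<le> L * quot_norm (quot_map M x)"
    using B by (auto simp: quot_bounded_op_def quot_space_def)
  have sub: "Y.subspace Y\<^sub>0" and cl: "closed Y\<^sub>0" and triv: "N \<inter> Y\<^sub>0 = {0}"
    using Y\<^sub>0 by (auto simp: closed_complement_def)
  have E: "?E x \<in> Y\<^sub>0" "quot_map N (?E x) = B (quot_map M x)" for x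
    by (rule Y.extension_op[OF N(1) Y\<^sub>0, where B = B, OF Bq])+
  have E_eqI: "?E x = y" if "y \<in> Y\<^sub>0" "B (quot_map M x) = quot_map N y" for x y
    using that E[of x] Y.closed_complement_unique[OF N(1) Y\<^sub>0, of "?E x" y]
    by (simp flip: Y.quot_map_eq_iff[OF N(1)])
  have add: "?E (x + y) = ?E x + ?E y" for x y
    by (rule E_eqI)
      (simp_all add: E B_add Y.subspace_add[OF sub] flip: Y.quot_add_quot_map[OF N(1)])
  have scale: "?E (sX c x) = sY c (?E x)" for c x
    by (rule E_eqI)
      (simp_all add: E B_scale Y.subspace_scale[OF sub] flip: Y.quot_scale_quot_map[OF N(1)])
  obtain D where D: "finite D" "D \<subseteq> N" "N \<subseteq> Y.span D"
    using N(2) unfolding finite_dim_def by blast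
  have sp: "Y.span D = N"
    using D(3) Y.span_minimal[OF D(2) N(1)] by blast
  obtain C where C: "C > 0" "\<And>y w. y \<in> Y\<^sub>0 \<Longrightarrow> w \<in> N \<Longrightarrow> norm y \<le> C * norm (y + w)"
    using Y.norm_le_add_span[OF D(1) sub cl] sp triv by auto
  have "norm (?E x) \<le> norm x * (C * \<bar>L\<bar>)" for x
  proof -
    have "norm (?E x) / C \<le> quot_norm (quot_map N (?E x))"
      using C(1) C(2)[OF E(1)] Y.subspace_0[OF N(1)]
      by (intro quot_norm_ge) (auto simp: field_simps)
    also have "\<dots> \<le> L * quot_norm (quot_map M x)" using L by (simp add: E)
    \<comment> \<open>The constant \<open>L\<close> may be negative; its absolute value is needed
      for the monotonicity step that follows.\<close>
    also have "\<dots> \<le> \<bar>L\<bar> * quot_norm (quot_map M x)"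
      using quot_norm_ge[of M 0 x] X.subspace_0[OF M] by (intro mult_right_mono) auto
    also have "\<dots> \<le> \<bar>L\<bar> * norm x"
      using quot_norm_le[of M x] X.subspace_0[OF M] by (intro mult_left_mono) auto
    finally show ?thesis using C(1) by (simp add: field_simps)
  qed
  moreover have "?E (r *\<^sub>R x) = r *\<^sub>R ?E x" for r x
    using scale[of "of_real r" x] by (simp add: X.scale_of_real Y.scale_of_real)
  ultimately show ?thesis
    unfolding bounded_op_def using add scale by (auto intro!: bounded_linear_intro)
qed

section \<open>From the quotient operators to the relations between the extensions\<close>

lemma bounded_op_linear:
  assumes "banach_over sX" "banach_over sY" "bounded_op sX sY A"
  shows "Vector_Spaces.linear sX sY A"
proof -
  interpret X: banach_over sX by (rule assms)
  interpret Y: banach_over sY by (rule assms)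
  have "bounded_linear A" using assms(3) by (simp add: bounded_op_def)
  then show ?thesis
    using assms(3) by unfold_locales (simp_all add: bounded_op_def
        linear_add bounded_linear.linear)
qed

text \<open>Each coset equation is rewritten with representatives. It yields membership in
  \<open>M\<close> or \<open>N\<close> in general, and equality when both sides take values in
  \<open>X\<^sub>0\<close> or \<open>Y\<^sub>0\<close>.\<close>

lemma partial_inverse_pair_extension_op:
  assumes X: "banach_over sX" and Y: "banach_over sY"
    and S: "bounded_op sX sY S" and T: "bounded_op sY sX T"
    and M: "M = range (T \<circ> S)" "finite_dim sX M"
    and N: "N = range (S \<circ> T)" "finite_dim sY N"
    and Sq: "induced_op S M N Sq" and Tq: "induced_op T N M Tq"
    and Sq': "quot_normalized_ginv sX M sY N Sq Sq'"
    and Tq': "quot_normalized_ginv sY N sX M Tq Tq'"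
    and Sq'_Tq': "\<forall>C\<in>quot_space M. Sq' (Tq' C) = quot_map M 0"
    and Tq'_Sq': "\<forall>D\<in>quot_space N. Tq' (Sq' D) = quot_map N 0"
    and X\<^sub>0: "closed_complement sX M X\<^sub>0" and Y\<^sub>0: "closed_complement sY N Y\<^sub>0"
    and S': "S' = extension_op N M X\<^sub>0 Sq'" and T': "T' = extension_op M N Y\<^sub>0 Tq'"
  shows "partial_inverse_pair sX sY S T S' T' M N"
    and "bounded_op sX sY (\<lambda>x. S x + T' x)"
proof -
  interpret X: banach_over sX by (rule X)
  interpret Y: banach_over sY by (rule Y)
  interpret S: Vector_Spaces.linear sX sY S by (rule bounded_op_linear[OF X Y S])
  interpret T: Vector_Spaces.linear sY sX T by (rule bounded_op_linear[OF Y X T])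
  have "X.subspace (T ` S ` UNIV)" "Y.subspace (S ` T ` UNIV)"
    by (intro T.subspace_image S.subspace_image X.subspace_UNIV Y.subspace_UNIV)+
  then have sM: "X.subspace M" and sN: "Y.subspace N"
    by (simp_all add: M N image_comp)
  have bSq': "quot_bounded_op sY N sX M Sq'" and bTq': "quot_bounded_op sX M sY N Tq'"
    using Sq' Tq' by (simp_all add: quot_normalized_ginv_def)
  have bS': "bounded_op sY sX S'"
    unfolding S' by (rule bounded_extension_op[OF Y X sN sM M(2) X\<^sub>0 bSq'])
  have bT': "bounded_op sX sY T'"
    unfolding T' by (rule bounded_extension_op[OF X Y sM sN N(2) Y\<^sub>0 bTq'])
  interpret S': Vector_Spaces.linear sY sX S' by (rule bounded_op_linear[OF Y X bS'])
  interpret T': Vector_Spaces.linear sX sY T' by (rule bounded_op_linear[OF X Y bT'])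
  have "Sq' (quot_map N y) \<in> quot_space M" "Tq' (quot_map M x) \<in> quot_space N" for x y
    using bSq' bTq' by (auto simp: quot_bounded_op_def quot_space_def)
  then have S'_X\<^sub>0: "S' y \<in> X\<^sub>0" and qS': "Sq' (quot_map N y) = quot_map M (S' y)"
    and T'_Y\<^sub>0: "T' x \<in> Y\<^sub>0" and qT': "Tq' (quot_map M x) = quot_map N (T' x)" for x y
    using X.extension_op[OF sM X\<^sub>0, of Sq' N y] Y.extension_op[OF sN Y\<^sub>0, of Tq' M x]
    by (simp_all add: S' T')
  have q: "Sq (quot_map M x) = quot_map N (S x)" "Tq (quot_map N y) = quot_map M (T y)" for x y
    using Sq Tq by (simp_all add: induced_op_def)
  have 0: "0 \<in> X\<^sub>0" "0 \<in> Y\<^sub>0"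
    using X\<^sub>0 Y\<^sub>0 X.subspace_0 Y.subspace_0 by (auto simp: closed_complement_def)
  note eqX = X.closed_complement_unique[OF sM X\<^sub>0] and eqY = Y.closed_complement_unique[OF sN Y\<^sub>0]
  have mem: "quot_map M x \<in> quot_space M" "quot_map N y \<in> quot_space N" for x y
    by (simp_all add: quot_space_def)
  show "partial_inverse_pair sX sY S T S' T' M N"
  proof unfold_locales
    show "S' y = 0" if "y \<in> N" for y
    proof -
      have "quot_map N y = quot_map N 0" using that by (simp add: Y.quot_map_eq_iff[OF sN])
      then show ?thesis using S'.zero by (simp add: S' extension_op_def)
    qed
    show "T' x = 0" if "x \<in> M" for x
    proof -
      have "quot_map M x = quot_map M 0" using that by (simp add: X.quot_map_eq_iff[OF sM])
      then show ?thesis using T'.zero by (simp add: T' extension_op_def)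
    qed
    show "S x - S (S' (S x)) \<in> N" for x
    proof -
      have "Sq (quot_map M x) = Sq (Sq' (Sq (quot_map M x)))"
        using Sq' mem(1) unfolding quot_normalized_ginv_def by blast
      then show ?thesis by (simp add: q qS' Y.quot_map_eq_iff[OF sN])
    qed
    show "T y - T (T' (T y)) \<in> M" for y
    proof -
      have "Tq (quot_map N y) = Tq (Tq' (Tq (quot_map N y)))"
        using Tq' mem(2) unfolding quot_normalized_ginv_def by blast
      then show ?thesis by (simp add: q qT' X.quot_map_eq_iff[OF sM])
    qed
    show "T' (T (T' x)) = T' x" for x
    proof -
      have "Tq' (quot_map M x) = Tq' (Tq (Tq' (quot_map M x)))"
        using Tq' mem(1) unfolding quot_normalized_ginv_def by blast
      then have "T' x - T' (T (T' x)) \<in> N" by (simp add: q qT' Y.quot_map_eq_iff[OF sN])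
      then show ?thesis using eqY[OF T'_Y\<^sub>0 T'_Y\<^sub>0] by metis
    qed
    show "S' (T' x) = 0" for x
    proof (rule eqX[OF S'_X\<^sub>0 0(1)])
      have "Sq' (Tq' (quot_map M x)) = quot_map M 0" using Sq'_Tq' mem(1) by blast
      then show "S' (T' x) - 0 \<in> M" by (simp add: qS' qT' X.quot_map_eq_iff[OF sM])
    qed
    show "T' (S' y) = 0" for y
    proof (rule eqY[OF T'_Y\<^sub>0 0(2)])
      have "Tq' (Sq' (quot_map N y)) = quot_map N 0" using Tq'_Sq' mem(2) by blast
      then show "T' (S' y) - 0 \<in> N" by (simp add: qS' qT' Y.quot_map_eq_iff[OF sN])
    qed
    show "T' x = 0" if "T' x \<in> N" for x
      using eqY[OF T'_Y\<^sub>0 0(2)] that by simp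
  qed (rule M N)+
  show "bounded_op sX sY (\<lambda>x. S x + T' x)"
    using S bT' by (auto simp: bounded_op_def Y.scale_right_distrib intro: bounded_linear_add)
qed

theorem theorem3p4:
  fixes sX :: "'k::{real_normed_field,banach} \<Rightarrow> 'a::banach \<Rightarrow> 'a"
    and sY :: "'k \<Rightarrow> 'b::banach \<Rightarrow> 'b"
    and S :: "'a \<Rightarrow> 'b" and T :: "'b \<Rightarrow> 'a"
    and M :: "'a set" and N :: "'b set"
    and Sq :: "'a set \<Rightarrow> 'b set" and Tq :: "'b set \<Rightarrow> 'a set"
    and Sq' :: "'b set \<Rightarrow> 'a set" and Tq' :: "'a set \<Rightarrow> 'b set"
    and X\<^sub>0 :: "'a set" and Y\<^sub>0 :: "'b set"
    and S' :: "'b \<Rightarrow> 'a" and T' :: "'a \<Rightarrow> 'b"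
  assumes X: "banach_over sX" and Y: "banach_over sY"
    and S: "regular_op sX sY S" and T: "regular_op sY sX T"
    and M: "M = range (T \<circ> S)" "finite_dim sX M"
    and N: "N = range (S \<circ> T)" "finite_dim sY N"
    and Sq: "induced_op S M N Sq" and Tq: "induced_op T N M Tq"
    and Sq': "quot_normalized_ginv sX M sY N Sq Sq'"
    and Tq': "quot_normalized_ginv sY N sX M Tq Tq'"
    and Sq'_Tq': "\<forall>C\<in>quot_space M. Sq' (Tq' C) = quot_map M 0"
    and Tq'_Sq': "\<forall>D\<in>quot_space N. Tq' (Sq' D) = quot_map N 0"
    and X\<^sub>0: "closed_complement sX M X\<^sub>0" and Y\<^sub>0: "closed_complement sY N Y\<^sub>0"
    and S': "S' = extension_op N M X\<^sub>0 Sq'" and T': "T' = extension_op M N Y\<^sub>0 Tq'"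
  shows "(regular_fredholm_pair sX sY S T \<longleftrightarrow> fredholm_op sX sY (\<lambda>x. S x + T' x))
       \<and> (regular_fredholm_pair sX sY S T \<longleftrightarrow> fredholm_op sY sX (\<lambda>y. T y + S' y))
       \<and> (regular_fredholm_pair sX sY S T \<longrightarrow>
            fredholm_pair_index sX sY S T = fredholm_index sX sY (\<lambda>x. S x + T' x)
          \<and> fredholm_index sX sY (\<lambda>x. S x + T' x) = - fredholm_index sY sX (\<lambda>y. T y + S' y))"
proof -
  have bS: "bounded_op sX sY S" and bT: "bounded_op sY sX T"
    using S T by (auto simp: regular_op_def)
  note ST = partial_inverse_pair_extension_op[OF X Y bS bT M N Sq Tq Sq' Tq' Sq'_Tq' Tq'_Sq' X\<^sub>0 Y\<^sub>0 S' T']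
  note TS = partial_inverse_pair_extension_op[OF Y X bT bS N M Tq Sq Tq' Sq' Tq'_Sq' Sq'_Tq' Y\<^sub>0 X\<^sub>0 T' S']
  interpret ST: partial_inverse_pair sX sY S T S' T' M N by (rule ST(1))
  interpret TS: partial_inverse_pair sY sX T S T' S' N M by (rule TS(1))
  \<comment> \<open>All three statements are compared with \<open>fin\<close>. The other two
    dimensions in the definition of a Fredholm pair are finite because \<open>M\<close> and
    \<open>N\<close> are.\<close>
  define fin where "fin \<longleftrightarrow> quot_finite_dim sX (null_space S) (null_space S \<inter> range T) \<and>
    quot_finite_dim sY (null_space T) (null_space T \<inter> range S)"
  have pair: "regular_fredholm_pair sX sY S T \<longleftrightarrow> fin"
    unfolding regular_fredholm_pair_def fredholm_pair_def fin_def
    using S T bS bT ST.finite_dim_pair by blast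
  have op1: "fredholm_op sX sY (\<lambda>x. S x + T' x) \<longleftrightarrow> fin"
    unfolding fredholm_op_def fin_def
    using ST(2) ST.finite_dim_null_A_iff[unfolded ST.A_def]
      ST.quot_finite_dim_range_A_iff[unfolded ST.A_def] by simp
  have op2: "fredholm_op sY sX (\<lambda>y. T y + S' y) \<longleftrightarrow> fin"
    unfolding fredholm_op_def fin_def
    using TS(2) TS.finite_dim_null_A_iff[unfolded TS.A_def]
      TS.quot_finite_dim_range_A_iff[unfolded TS.A_def] by auto
  have "fredholm_index sX sY (\<lambda>x. S x + T' x) = fredholm_pair_index sX sY S T" if fin
    using that ST.fredholm_index_A[unfolded ST.A_def] by (simp add: fin_def)
  moreover have "fredholm_index sY sX (\<lambda>y. T y + S' y) = fredholm_pair_index sY sX T S" if fin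
    using that TS.fredholm_index_A[unfolded TS.A_def] by (simp add: fin_def)
  \<comment> \<open>Swapping the operators exchanges the first dimension with the third and the
    second with the fourth, which reverses all signs.\<close>
  moreover have "fredholm_pair_index sY sX T S = - fredholm_pair_index sX sY S T"
    by (simp add: fredholm_pair_index_def)
  ultimately show ?thesis
    using pair op1 op2 by simp
qed

end
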